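(* Let $S\ge 3$. As $n\to\infty$, $$E(n,n,\dots,n)\sim\frac{\sqrt{S}\,(S-1)^{Sn+S-1}}{\big(2S(S-2)\pi n\big)^{\frac{S-1}{2}}},$$ where $E$ has $S$ arguments all equal to $n$. Equivalently, $E(n,\dots,n)\sim\left(\frac{S-1}{\sqrt{S(S-2)}}\right)^{S-1}\left(1-\frac1S\right)^{Sn}\frac{(Sn)!}{(n!)^S}$.
   Context: For nonnegative integers $n_1,\dots,n_S$, $E(n_1,\dots,n_S)$ denotes the number of block derangements: $S$ players hold $n_1,\dots,n_S$ distinct cards respectively; all $N=n_1+\dots+n_S$ cards are redealt so that player $j$ again receives exactly $n_j$ cards (only which cards each player gets matters); $E$ counts the deals in which no player receives any card he originally held. Equivalently, $E(n_1,\dots,n_S)$ is the coefficient of $x_1^{n_1}\cdots x_S^{n_S}$ in $\prod_{j=1}^S(x_1+\dots+x_S-x_j)^{n_j}$. *)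

theory Defs
  imports "HOL-Library.FuncSet" "HOL-Library.Landau_Symbols" Complex_Main
begin

text \<open>Players are 0,...,S-1; player j originally holds the cards (j,k) with k < n j.
  A deal assigns to each card the player receiving it.\<close>

definition cards :: "nat \<Rightarrow> (nat \<Rightarrow> nat) \<Rightarrow> (nat \<times> nat) set" where
  "cards S n = {(j, k). j < S \<and> k < n j}"

definition block_derangements :: "nat \<Rightarrow> (nat \<Rightarrow> nat) \<Rightarrow> ((nat \<times> nat) \<Rightarrow> nat) set" where
  "block_derangements S n =
     {d \<in> cards S n \<rightarrow>\<^sub>E {..<S}.
        (\<forall>c \<in> cards S n. d c \<noteq> fst c) \<and>
        (\<forall>i < S. card {c \<in> cards S n. d c = i} = n i)}"

definition E :: "nat \<Rightarrow> (nat \<Rightarrow> nat) \<Rightarrow> nat" where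
  "E S n = card (block_derangements S n)"

end

theory Submission
  imports Defs "HOL-Probability.Characteristic_Functions"
begin

text \<open>Put S = d + 1. A deal avoiding all original cards is counted as soon as the first d players
  receive n cards each, so E is a d-dimensional Fourier coefficient of a product of averages of
  unit complex numbers. In the coordinates \<open>x = \<surd>n \<theta>\<close> the n-th powers of these averages converge
  to a Gaussian. They are also dominated by a Gaussian on the whole box because for d \<ge> 2 every
  angle occurs together with the angle 0 of the last player in one of the averages. Dominated
  convergence leaves a Gaussian integral whose quadratic form is a multiple of
  \<open>(d + 1) \<Sum>x\<^sub>i\<^sup>2 - (\<Sum>x\<^sub>i)\<^sup>2\<close>.\<close>

section \<open>Unit complex numbers: orthogonality, central limit, Gaussian bound\<close>

text \<open>Orthogonality of characters in a variable stretched by r. The interval enters as an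
  indicator, so that with \<open>r = sqrt n\<close> all n share one product measure, as dominated
  convergence requires.\<close>

lemma integral_cis_period:
  fixes k :: int and r :: real
  assumes "r > 0"
  defines "f \<equiv> \<lambda>t. indicator {-(pi * r)..pi * r} t *\<^sub>R cis (of_int k * t / r)"
  shows "integrable lborel f"
    and "integral\<^sup>L lborel f = (if k = 0 then of_real (2 * pi * r) else 0)"
proof -
  have le: "-(pi * r) \<le> pi * r" using assms by simp
  have "continuous_on {-(pi * r)..pi * r} (\<lambda>t. cis (of_int k * t / r))"
    unfolding cis_conv_exp by (intro continuous_intros) (use assms in auto)
  then show "integrable lborel f"
    unfolding f_def by (intro borel_integrable_compact) auto
  show "integral\<^sup>L lborel f = (if k = 0 then of_real (2 * pi * r) else 0)"
  proof (cases "k = 0")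
    case True
    then show ?thesis using assms by (simp add: f_def scaleR_conv_of_real)
  next
    case False
    define F where "F t = cis (of_int k * t / r) * (of_real r / (\<i> * of_int k))" for t
    have "integral\<^sup>L lborel f = F (pi * r) - F (-(pi * r))"
      unfolding f_def
    proof (rule integral_FTC_atLeastAtMost[OF le])
      fix t
      show "(F has_vector_derivative cis (of_int k * t / r)) (at t within {-(pi * r)..pi * r})"
      proof -
        have "((\<lambda>z. exp (\<i> * (of_int k * z / of_real r)) * (of_real r / (\<i> * of_int k))) has_field_derivative
                exp (\<i> * (of_int k * of_real t / of_real r))) (at (complex_of_real t))"
          using False \<open>r > 0\<close> by (auto intro!: derivative_eq_intros simp: mult_ac)
        from has_vector_derivative_real_field[OF this]
        show ?thesis by (simp add: F_def[abs_def] cis_conv_exp)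
      qed
    qed fact
    also have "\<dots> = 0"
    proof -
      have "cis (of_int k * pi) = cis (- (of_int k * pi))"
        using sin_npi_int[of k] by (simp add: complex_eq_iff mult.commute)
      then show ?thesis using assms by (simp add: F_def)
    qed
    finally show ?thesis using False by simp
  qed
qed

text \<open>A central limit theorem for the uniform distribution on the values \<open>y i\<close>.
  Mean zero kills the linear Taylor term, so the base is \<open>1 - V / n\<close> up to order
  \<open>1 / (n * sqrt n)\<close>. For bases in the unit disc, n-th powers differ by at most n times
  the difference of the bases, which leaves an error of order \<open>1 / sqrt n\<close>.\<close>

lemma cis_uniform_power_limit:
  fixes y :: "'a \<Rightarrow> real"
  assumes A: "finite A" "A \<noteq> {}" and y0: "(\<Sum>i\<in>A. y i) = 0"
  shows "(\<lambda>n. ((\<Sum>i\<in>A. cis (y i / sqrt (real n))) / of_nat (card A)) ^ n)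
          \<longlonglongrightarrow> of_real (exp (- (\<Sum>i\<in>A. (y i)\<^sup>2) / (2 * real (card A))))"
proof -
  define V where "V = (\<Sum>i\<in>A. (y i)\<^sup>2) / (2 * real (card A))"
  define C where "C = (\<Sum>i\<in>A. \<bar>y i\<bar> ^ 3)"
  define \<psi> where "\<psi> n = (\<Sum>i\<in>A. cis (y i / sqrt (real n))) / of_nat (card A)" for n
  have cA: "real (card A) \<ge> 1" using A by (simp add: Suc_le_eq card_gt_0_iff)
  have V: "V \<ge> 0" by (auto simp: V_def intro!: divide_nonneg_nonneg sum_nonneg)
  have main: "norm (\<psi> n ^ n - of_real ((1 + - V / n) ^ n)) \<le> C / sqrt n" if n: "n \<ge> 1" "real n \<ge> V" for n :: nat
  proof -
    have n1: "norm (\<psi> n) \<le> 1"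
    proof -
      have "norm (\<Sum>i\<in>A. cis (y i / sqrt (real n))) \<le> card A"
        by (rule order_trans[OF norm_sum]) simp
      then show ?thesis using cA by (simp add: \<psi>_def norm_divide)
    qed
    \<comment> \<open>The assumption \<open>real n \<ge> V\<close> places the real base in the
      interval from 0 to 1.\<close>
    have n2: "norm (of_real (1 + - V / n) :: complex) \<le> 1"
      using V n by (simp only: norm_of_real) (simp add: abs_le_iff field_simps)
    \<comment> \<open>Second-order Taylor polynomial; the factor 1/6 of the remainder is given
      away.\<close>
    have approx: "cmod (cis (y i / sqrt n) - (1 + \<i> * (y i / sqrt n) - of_real ((y i)\<^sup>2 / (2 * n)))) \<le> \<bar>y i\<bar> ^ 3 / (n * sqrt n)" for i
    proof -
      have *: "cis (y i / sqrt n) = iexp (y i / sqrt n)"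
        by (simp add: cis_conv_exp)
      have sum: "(\<Sum>k\<le>2. (\<i> * complex_of_real (y i / sqrt n)) ^ k / fact k) =
         1 + \<i> * (y i / sqrt n) - of_real ((y i)\<^sup>2 / (2 * n))"
      proof -
        have "(complex_of_real (y i / sqrt n))\<^sup>2 = of_real ((y i)\<^sup>2 / n)"
          by (simp flip: of_real_power add: power_divide)
        then show ?thesis
          by (simp add: eval_nat_numeral atMost_Suc algebra_simps del: of_real_divide)
             (simp add: field_simps)
      qed
      have "cmod (cis (y i / sqrt n) - (1 + \<i> * (y i / sqrt n) - of_real ((y i)\<^sup>2 / (2 * n))))
         \<le> \<bar>y i / sqrt n\<bar> ^ Suc 2 / fact (Suc 2)"
        using iexp_approx1[of "y i / sqrt n" 2] unfolding * sum .
      also have "\<dots> = \<bar>y i / sqrt n\<bar> ^ 3 / 6"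
        by (simp add: numeral_3_eq_3)
      also have "\<dots> \<le> \<bar>y i / sqrt n\<bar> ^ 3"
        by simp
      also have "\<dots> = \<bar>y i\<bar> ^ 3 / (n * sqrt n)"
        by (simp add: power_divide eval_nat_numeral abs_mult)
      finally show ?thesis .
    qed
    have "\<psi> n - of_real (1 + - V / n) =
       (\<Sum>i\<in>A. cis (y i / sqrt n) - (1 + \<i> * (y i / sqrt n) - of_real ((y i)\<^sup>2 / (2 * n)))) / of_nat (card A)"
    proof -
      have 1: "(\<Sum>i\<in>A. \<i> * complex_of_real (y i / sqrt n)) = 0"
        by (simp flip: sum_distrib_left of_real_sum sum_divide_distrib add: y0 del: of_real_divide)
      have 2: "(\<Sum>i\<in>A. complex_of_real ((y i)\<^sup>2 / (2 * n))) = of_real (card A * V / n)"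
        using cA by (simp flip: of_real_sum sum_divide_distrib add: V_def del: of_real_divide)
      have "(\<Sum>i\<in>A. cis (y i / sqrt n) - (1 + \<i> * (y i / sqrt n) - of_real ((y i)\<^sup>2 / (2 * n))))
         = (\<Sum>i\<in>A. cis (y i / sqrt n)) - (of_nat (card A) + 0 - of_real (card A * V / n))"
        unfolding sum_subtractf sum.distrib 1 2 by simp
      then show ?thesis using cA by (simp add: \<psi>_def field_simps)
    qed
    then have "norm (\<psi> n - of_real (1 + - V / n)) = norm (\<Sum>i\<in>A. cis (y i / sqrt n) - (1 + \<i> * (y i / sqrt n) - of_real ((y i)\<^sup>2 / (2 * n)))) / card A"
      by (simp add: norm_divide)
    also have "\<dots> \<le> norm (\<Sum>i\<in>A. cis (y i / sqrt n) - (1 + \<i> * (y i / sqrt n) - of_real ((y i)\<^sup>2 / (2 * n)))) / 1"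
      using cA by (intro divide_left_mono) auto
    also have "\<dots> \<le> (\<Sum>i\<in>A. \<bar>y i\<bar> ^ 3 / (n * sqrt n))"
      unfolding div_by_1 by (intro order_trans[OF norm_sum] sum_mono approx)
    also have "\<dots> = C / (n * sqrt n)"
      by (simp add: C_def sum_divide_distrib)
    finally have "norm (\<psi> n - of_real (1 + - V / n)) \<le> C / (n * sqrt n)" .
    then have "real n * norm (\<psi> n - of_real (1 + - V / n)) \<le> real n * (C / (n * sqrt n))"
      by (intro mult_left_mono) auto
    moreover have "norm (\<psi> n ^ n - of_real (1 + - V / n) ^ n) \<le> n * norm (\<psi> n - of_real (1 + - V / n))"
      by (intro norm_power_diff n1 n2)
    ultimately show ?thesis using n by simp
  qed
  have "\<forall>\<^sub>F n in sequentially. norm (\<psi> n ^ n - of_real ((1 + - V / n) ^ n)) \<le> C / sqrt n"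
  proof (rule eventually_sequentiallyI)
    fix n assume "n \<ge> max 1 (nat \<lceil>V\<rceil>)"
    then show "norm (\<psi> n ^ n - of_real ((1 + - V / n) ^ n)) \<le> C / sqrt n"
      by (intro main) (auto simp: nat_ceiling_le_eq)
  qed
  moreover have "(\<lambda>n. C / sqrt (real n)) \<longlonglongrightarrow> 0"
    by (intro tendsto_divide_0[OF tendsto_const] filterlim_at_top_imp_at_infinity
         filterlim_compose[OF sqrt_at_top] filterlim_real_sequentially)
  ultimately have "(\<lambda>n. \<psi> n ^ n - of_real ((1 + - V / n) ^ n)) \<longlonglongrightarrow> 0"
    by (rule Lim_null_comparison)
  moreover have "(\<lambda>n. complex_of_real ((1 + - V / n) ^ n)) \<longlonglongrightarrow> of_real (exp (- V))"
    by (intro tendsto_of_real tendsto_exp_limit_sequentially)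
  ultimately have "(\<lambda>n. \<psi> n ^ n) \<longlonglongrightarrow> of_real (exp (- V))"
    by (rule Lim_transform[rotated])
  then show ?thesis by (simp add: \<psi>_def V_def)
qed

text \<open>With \<open>u = \<bar>x\<bar> / 2\<close> one has
  \<open>1 - cos x = 2 * (sin u)\<^sup>2\<close>. The crude bound \<open>pi < 4\<close> gives
  \<open>u \<le> 2\<close>, where \<open>sin u \<ge> u - u ^ 3 / 6 \<ge> u / 3\<close>; hence the
  constant 18.\<close>

lemma one_minus_cos_ge:
  fixes x :: real
  assumes "\<bar>x\<bar> \<le> pi"
  shows "1 - cos x \<ge> x\<^sup>2 / 18"
proof -
  define u where "u = \<bar>x\<bar> / 2"
  have u: "0 \<le> u" "u \<le> 2" using assms pi_less_4 by (auto simp: u_def)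
  have "\<bar>sin u - (\<Sum>m<3. sin_coeff m * u ^ m)\<bar> \<le> inverse (fact 3) * \<bar>u\<bar> ^ 3"
    by (rule Maclaurin_sin_bound)
  moreover have "(\<Sum>m<3. sin_coeff m * u ^ m) = u"
    by (simp add: eval_nat_numeral sin_coeff_def)
  moreover have "inverse (fact 3) * \<bar>u\<bar> ^ 3 = u ^ 3 / 6"
    using u by (simp add: eval_nat_numeral)
  ultimately have "u - u ^ 3 / 6 \<le> sin u" by linarith
  moreover have "u ^ 3 / 6 \<le> u * (2 / 3)"
  proof -
    have "u\<^sup>2 \<le> 2\<^sup>2" using u by (intro power_mono) auto
    then have "u * u\<^sup>2 \<le> u * 4" using u by (intro mult_left_mono) auto
    then show ?thesis by (simp add: eval_nat_numeral)
  qed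
  ultimately have "(u / 3)\<^sup>2 \<le> (sin u)\<^sup>2"
    using u by (intro power_mono) auto
  moreover have "cos x = 1 - 2 * (sin u)\<^sup>2"
    using cos_double_sin[of u] by (simp add: u_def)
  ultimately show ?thesis by (simp add: u_def power2_eq_square)
qed

text \<open>The squared norm of the sum is \<open>m\<^sup>2\<close> minus the sum of
  \<open>1 - cos (\<theta> i - \<theta> k)\<close> over all pairs. These terms are nonnegative, and
  keeping only \<open>k = a\<close>, where the angle is 0, already leaves a multiple of every
  \<open>(\<theta> i)\<^sup>2\<close>. Taking the square root at the end turns 18 into 36.\<close>

lemma norm_average_cis_le:
  fixes \<theta> :: "'a \<Rightarrow> real"
  assumes A: "finite A" "a \<in> A" "\<theta> a = 0" "\<And>i. i \<in> A \<Longrightarrow> \<bar>\<theta> i\<bar> \<le> pi"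
  shows "norm ((\<Sum>i\<in>A. cis (\<theta> i)) / of_nat (card A)) \<le> exp (- (\<Sum>i\<in>A. (\<theta> i)\<^sup>2) / (36 * (real (card A))\<^sup>2))"
proof -
  define m where "m = real (card A)"
  define z where "z = (\<Sum>i\<in>A. cis (\<theta> i))"
  have m: "m > 0" using A by (auto simp: m_def card_gt_0_iff)
  have "(norm z)\<^sup>2 = (\<Sum>i\<in>A. cos (\<theta> i))\<^sup>2 + (\<Sum>i\<in>A. sin (\<theta> i))\<^sup>2"
    by (simp add: cmod_power2 z_def)
  also have "\<dots> = (\<Sum>i\<in>A. \<Sum>k\<in>A. cos (\<theta> i - \<theta> k))"
    by (simp add: power2_eq_square sum_product cos_diff sum.distrib)
  also have "\<dots> = m\<^sup>2 - (\<Sum>i\<in>A. \<Sum>k\<in>A. 1 - cos (\<theta> i - \<theta> k))"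
    by (simp add: sum_subtractf m_def power2_eq_square)
  finally have "(norm z)\<^sup>2 = m\<^sup>2 - (\<Sum>i\<in>A. \<Sum>k\<in>A. 1 - cos (\<theta> i - \<theta> k))" .
  moreover have "(\<Sum>i\<in>A. (\<theta> i)\<^sup>2 / 18) \<le> (\<Sum>i\<in>A. \<Sum>k\<in>A. 1 - cos (\<theta> i - \<theta> k))"
  proof (rule sum_mono)
    fix i assume i: "i \<in> A"
    have "(\<theta> i)\<^sup>2 / 18 \<le> 1 - cos (\<theta> i - \<theta> a)"
      using one_minus_cos_ge[of "\<theta> i"] A i by simp
    also have "\<dots> \<le> (\<Sum>k\<in>A. 1 - cos (\<theta> i - \<theta> k))"
      using A by (intro member_le_sum) auto
    finally show "(\<theta> i)\<^sup>2 / 18 \<le> (\<Sum>k\<in>A. 1 - cos (\<theta> i - \<theta> k))" .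
  qed
  ultimately have "(norm z)\<^sup>2 \<le> m\<^sup>2 - (\<Sum>i\<in>A. (\<theta> i)\<^sup>2 / 18)" by simp
  then have "(norm (z / of_real m))\<^sup>2 \<le> 1 + - (\<Sum>i\<in>A. (\<theta> i)\<^sup>2) / (18 * m\<^sup>2)"
    using m by (simp add: norm_divide power_divide divide_simps sum_divide_distrib[symmetric])
  also have "\<dots> \<le> exp (- (\<Sum>i\<in>A. (\<theta> i)\<^sup>2) / (18 * m\<^sup>2))"
    by (rule exp_ge_add_one_self)
  also have "\<dots> = (exp (- (\<Sum>i\<in>A. (\<theta> i)\<^sup>2) / (36 * m\<^sup>2)))\<^sup>2"
    by (simp flip: exp_double add: field_simps)
  finally show ?thesis
    unfolding z_def m_def by (simp add: power2_le_iff_abs_le)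
qed

section \<open>The number of deals as a Fourier coefficient\<close>

text \<open>All \<open>d + 1\<close> counts add up to \<open>Suc d * m\<close>, so the first d of
  them force the last. The ban on original owners moves into the dependent function space, the shape
  in which \<open>prod_sum_PiE\<close> expands a product of sums.\<close>

lemma E_eq_card_box_derangements:
  "E (Suc d) (\<lambda>_. m) =
     card {f \<in> PiE (cards (Suc d) (\<lambda>_. m)) (\<lambda>c. {..<Suc d} - {fst c}).
           \<forall>i<d. card {c \<in> cards (Suc d) (\<lambda>_. m). f c = i} = m}"
proof -
  let ?C = "cards (Suc d) (\<lambda>_. m)"
  have C: "?C = {..<Suc d} \<times> {..<m}" by (auto simp: cards_def)
  have fin: "finite ?C" and cC: "card ?C = Suc d * m" by (simp_all add: C)
  have last: "card {c \<in> ?C. f c = d} = m"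
    if f: "f \<in> PiE ?C (\<lambda>c. {..<Suc d} - {fst c})" and eq: "\<forall>i<d. card {c \<in> ?C. f c = i} = m" for f
  proof -
    have "(\<Sum>i<Suc d. card {c \<in> ?C. f c = i}) = card ?C"
      using sum.group[OF fin, of "{..<Suc d}" f "\<lambda>_. 1::nat"] f by (force simp: PiE_iff)
    then show ?thesis using eq by (simp add: cC)
  qed
  show ?thesis
    unfolding E_def block_derangements_def
    by (rule arg_cong[where f = card]) (use last in \<open>auto simp: PiE_iff less_Suc_eq\<close>)
qed

text \<open>The last player carries no angle, since his count is determined by the others.\<close>

definition angle :: "nat \<Rightarrow> (nat \<Rightarrow> real) \<Rightarrow> nat \<Rightarrow> real" where
  "angle d x i = (if i < d then x i else 0)"

text \<open>The generating product of block derangements at the points \<open>cis (x i / r)\<close>,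
  with the last variable set to 1, times the characters that extract exponent m in each of the other
  d variables, cut off to one period.\<close>

definition deal_kernel :: "nat \<Rightarrow> nat \<Rightarrow> real \<Rightarrow> (nat \<Rightarrow> real) \<Rightarrow> complex" where
  "deal_kernel d m r x =
     (\<Prod>i<d. indicator {-(pi * r)..pi * r} (x i) *\<^sub>R cis (- (real m * x i / r))) *
     (\<Prod>j<Suc d. \<Sum>i\<in>{..<Suc d} - {j}. cis (angle d x i / r)) ^ m"

text \<open>Expanding the product over all cards yields one character for each way of giving every
  card to somebody other than its owner. Integration keeps exactly those ways with the right
  counts.\<close>

lemma integral_deal_kernel:
  assumes r: "r > 0"
  shows "(\<integral>x. deal_kernel d m r x \<partial>Pi\<^sub>M {..<d} (\<lambda>_. lborel)) =
           of_nat (E (Suc d) (\<lambda>_. m)) * of_real ((2 * pi * r) ^ d)"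
proof -
  interpret product_sigma_finite "\<lambda>_::nat. lborel :: real measure" by standard
  let ?C = "cards (Suc d) (\<lambda>_. m)"
  have C: "?C = {..<Suc d} \<times> {..<m}" by (auto simp: cards_def)
  have finC: "finite ?C" by (simp add: C)
  define D where "D = PiE ?C (\<lambda>c. {..<Suc d} - {fst c})"
  have finD: "finite D" unfolding D_def by (intro finite_PiE) (auto simp: finC)
  define N where "N f i = card {c \<in> ?C. f c = i}" for f :: "nat \<times> nat \<Rightarrow> nat" and i
  define g where "g f i t = indicator {-(pi * r)..pi * r} t *\<^sub>R cis (of_int (int (N f i) - int m) * t / r)"
    for f i t
  have kernel: "deal_kernel d m r x = (\<Sum>f\<in>D. \<Prod>i<d. g f i (x i))" for x
  proof -
    have "(\<Prod>j<Suc d. \<Sum>i\<in>{..<Suc d} - {j}. cis (angle d x i / r)) ^ m =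
          (\<Prod>c\<in>?C. \<Sum>i\<in>{..<Suc d} - {fst c}. cis (angle d x i / r))"
      unfolding C by (simp add: prod.cartesian_product' prod_power_distrib del: prod.lessThan_Suc)
    also have "\<dots> = (\<Sum>f\<in>D. \<Prod>c\<in>?C. cis (angle d x (f c) / r))"
      unfolding D_def by (rule prod_sum_PiE) (auto simp: finC)
    also have "\<dots> = (\<Sum>f\<in>D. \<Prod>i<d. cis (real (N f i) * x i / r))"
    proof (rule sum.cong[OF refl])
      fix f assume f: "f \<in> D"
      have "(\<Prod>c\<in>?C. cis (angle d x (f c) / r)) =
            (\<Prod>i<Suc d. \<Prod>c\<in>{c \<in> ?C. f c = i}. cis (angle d x (f c) / r))"
        using f by (intro prod.group[symmetric] finC) (auto simp: D_def PiE_iff)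
      also have "\<dots> = (\<Prod>i<Suc d. cis (angle d x i / r) ^ N f i)"
        by (intro prod.cong) (auto simp: N_def)
      \<comment> \<open>The factor \<open>i = d\<close> is a power of \<open>cis 0\<close> and drops
        out.\<close>
      also have "\<dots> = (\<Prod>i<d. cis (real (N f i) * x i / r))"
        by (simp add: angle_def Complex.DeMoivre)
      finally show "(\<Prod>c\<in>?C. cis (angle d x (f c) / r)) = (\<Prod>i<d. cis (real (N f i) * x i / r))" .
    qed
    finally show ?thesis
      by (simp add: deal_kernel_def g_def sum_distrib_left prod.distrib[symmetric] cis_mult
            diff_divide_distrib left_diff_distrib)
  qed
  have "(\<integral>x. deal_kernel d m r x \<partial>Pi\<^sub>M {..<d} (\<lambda>_. lborel)) =
        (\<Sum>f\<in>D. \<integral>x. (\<Prod>i<d. g f i (x i)) \<partial>Pi\<^sub>M {..<d} (\<lambda>_. lborel))"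
    unfolding kernel
    by (intro Bochner_Integration.integral_sum product_integrable_prod)
       (auto simp only: g_def intro!: integral_cis_period[OF r] finite_lessThan)
  also have "\<dots> = (\<Sum>f\<in>D. \<Prod>i<d. \<integral>t. g f i t \<partial>lborel)"
    by (intro sum.cong refl product_integral_prod)
       (auto simp only: g_def intro!: integral_cis_period[OF r] finite_lessThan)
  \<comment> \<open>A single nonzero frequency \<open>N f i - m\<close> annihilates the whole
    product of integrals.\<close>
  also have "\<dots> = (\<Sum>f\<in>D. if \<forall>i<d. N f i = m then of_real ((2 * pi * r) ^ d) else 0)"
    unfolding g_def integral_cis_period(2)[OF r] by (intro sum.cong) auto
  also have "\<dots> = of_nat (card {f\<in>D. \<forall>i<d. N f i = m}) * of_real ((2 * pi * r) ^ d)"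
    by (simp add: sum.If_cases finD Int_def)
  finally show ?thesis unfolding E_eq_card_box_derangements D_def N_def .
qed

section \<open>Gaussian integrals\<close>

text \<open>Completing the square exhibits a multiple of the normal density with mean
  \<open>b / a\<close> and standard deviation \<open>1 / sqrt a\<close>.\<close>

lemma nn_integral_exp_quadratic:
  fixes a b :: real
  assumes a: "a > 0"
  shows "(\<integral>\<^sup>+t. ennreal (exp (- a * t\<^sup>2 / 2 + b * t)) \<partial>lborel) = ennreal (sqrt (2 * pi / a) * exp (b\<^sup>2 / (2 * a)))"
proof -
  have eq: "exp (- a * t\<^sup>2 / 2 + b * t) =
      sqrt (2 * pi / a) * exp (b\<^sup>2 / (2 * a)) * normal_density (b / a) (1 / sqrt a) t" for t
  proof -
    have "- a * t\<^sup>2 / 2 + b * t = b\<^sup>2 / (2 * a) + - (t - b / a)\<^sup>2 / (2 * (1 / sqrt a)\<^sup>2)"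
      using a by (simp add: power2_eq_square field_simps)
    then show ?thesis
      using a by (simp add: normal_density_def exp_add[symmetric] power_divide)
  qed
  have "(\<integral>\<^sup>+t. ennreal (normal_density (b / a) (1 / sqrt a) t) \<partial>lborel) = 1"
    using a by (subst nn_integral_eq_integral) auto
  then show ?thesis
    unfolding eq using a by (simp add: ennreal_mult' nn_integral_cmult)
qed

text \<open>Writing \<^term>\<open>exp (c * T\<^sup>2 / 2)\<close> as a Gaussian integral over an auxiliary variable z decouples
  the coordinates, so that no determinant has to be evaluated.\<close>

lemma nn_integral_exp_equicorrelated:
  fixes c :: real
  assumes c: "c > 0"
  shows "(\<integral>\<^sup>+x. ennreal (exp (- (c / 2) * ((real d + 1) * (\<Sum>i<d. (x i)\<^sup>2) - (\<Sum>i<d. x i)\<^sup>2)))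
            \<partial>Pi\<^sub>M {..<d} (\<lambda>_. lborel)) =
         ennreal (sqrt (real d + 1) * sqrt (2 * pi / (c * (real d + 1))) ^ d)" (is "?lhs = _")
proof -
  interpret product_sigma_finite "\<lambda>_::nat. lborel :: real measure" by standard
  let ?P = "Pi\<^sub>M {..<d} (\<lambda>_. lborel :: real measure)"
  interpret P: sigma_finite_measure ?P by (rule sigma_finite) simp
  interpret pair_sigma_finite "lborel :: real measure" ?P by standard
  define a where "a = c * (real d + 1)"
  have a: "a > 0" using c by (simp add: a_def)
  \<comment> \<open>A standard normal density in z times a product over the coordinates. The linear
    terms add up to \<open>sqrt c * T * z\<close>, whose exponential has mean
    \<open>exp (c * T\<^sup>2 / 2)\<close> over z.\<close>
  define h where "h z x = ennreal (exp (- z\<^sup>2 / 2) / sqrt (2 * pi)) * (\<Prod>i<d. ennreal (exp (- a * (x i)\<^sup>2 / 2 + sqrt c * z * x i)))"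
    for z and x :: "nat \<Rightarrow> real"
  have [measurable]: "case_prod h \<in> borel_measurable (lborel \<Otimes>\<^sub>M ?P)"
    unfolding h_def by measurable
  have "ennreal (exp (- (c / 2) * ((real d + 1) * (\<Sum>i<d. (x i)\<^sup>2) - (\<Sum>i<d. x i)\<^sup>2))) = (\<integral>\<^sup>+z. h z x \<partial>lborel)" for x
  proof -
    define T where "T = (\<Sum>i<d. x i)"
    define U where "U = (\<Sum>i<d. (x i)\<^sup>2)"
    have "h z x = ennreal (exp (- a * U / 2) / sqrt (2 * pi)) * ennreal (exp (- 1 * z\<^sup>2 / 2 + sqrt c * T * z))" for z
    proof -
      have "(\<Prod>i<d. ennreal (exp (- a * (x i)\<^sup>2 / 2 + sqrt c * z * x i))) = ennreal (exp (- a * U / 2 + sqrt c * T * z))"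
      proof -
        have "(\<Sum>i<d. - a * (x i)\<^sup>2 / 2) = - a * U / 2"
          unfolding U_def sum_distrib_left sum_divide_distrib ..
        moreover have "(\<Sum>i<d. sqrt c * z * x i) = sqrt c * T * z"
          unfolding T_def by (simp add: sum_distrib_left[symmetric])
        ultimately show ?thesis
          by (simp only: prod_ennreal exp_ge_zero exp_sum[symmetric] finite_lessThan sum.distrib)
      qed
      then show ?thesis
        by (simp add: h_def ennreal_mult'[symmetric] exp_add[symmetric] mult_ac add_ac)
    qed
    then have "(\<integral>\<^sup>+z. h z x \<partial>lborel) =
        ennreal (exp (- a * U / 2) / sqrt (2 * pi)) * ennreal (sqrt (2 * pi / 1) * exp ((sqrt c * T)\<^sup>2 / (2 * 1)))"
      by (simp only:)
         (subst nn_integral_cmult, simp, simp only: nn_integral_exp_quadratic[OF zero_less_one])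
    also have "\<dots> = ennreal (exp (- a * U / 2) * exp (c * T\<^sup>2 / 2))"
      using c by (simp add: ennreal_mult'[symmetric] power_mult_distrib)
    also have "exp (- a * U / 2) * exp (c * T\<^sup>2 / 2) = exp (- (c / 2) * ((real d + 1) * U - T\<^sup>2))"
      by (simp add: exp_add[symmetric] a_def field_simps)
    finally show ?thesis by (simp add: T_def U_def)
  qed
  then have "?lhs = (\<integral>\<^sup>+x. \<integral>\<^sup>+z. h z x \<partial>lborel \<partial>?P)" by simp
  \<comment> \<open>Nonnegativity permits the exchange; for fixed z the inner integral then factors
    into d one-dimensional ones.\<close>
  also have "\<dots> = (\<integral>\<^sup>+z. \<integral>\<^sup>+x. h z x \<partial>?P \<partial>lborel)"
    by (rule Fubini') measurable
  also have "\<dots> = (\<integral>\<^sup>+z. ennreal (sqrt (2 * pi / a) ^ d / sqrt (2 * pi)) * ennreal (exp (- (1 / (real d + 1)) * z\<^sup>2 / 2 + 0 * z)) \<partial>lborel)"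
  proof (rule nn_integral_cong)
    fix z :: real
    define w where "w = (sqrt c * z)\<^sup>2 / (2 * a)"
    have "(\<integral>\<^sup>+x. h z x \<partial>?P) = ennreal (exp (- z\<^sup>2 / 2) / sqrt (2 * pi)) *
       (\<Prod>i<d. \<integral>\<^sup>+t. ennreal (exp (- a * t\<^sup>2 / 2 + sqrt c * z * t)) \<partial>lborel)"
      unfolding h_def by (subst nn_integral_cmult, measurable) (subst product_nn_integral_prod, auto)
    also have "\<dots> = ennreal (exp (- z\<^sup>2 / 2) / sqrt (2 * pi) * (sqrt (2 * pi / a) ^ d * exp (d * w)))"
      unfolding nn_integral_exp_quadratic[OF a] w_def[symmetric] using a
      by (simp add: ennreal_power ennreal_mult'[symmetric] power_mult_distrib exp_of_nat_mult)
    also have "exp (- z\<^sup>2 / 2) / sqrt (2 * pi) * (sqrt (2 * pi / a) ^ d * exp (d * w)) =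
       sqrt (2 * pi / a) ^ d / sqrt (2 * pi) * exp (- z\<^sup>2 / 2 + d * w)"
      by (simp add: exp_add[symmetric])
    \<comment> \<open>As \<open>a = c * (d + 1)\<close>, the coefficient of \<open>z\<^sup>2\<close>
      is \<open>- 1 / 2 + d / (2 * (d + 1))\<close>, which is still negative; its reciprocal
      supplies the factor \<open>sqrt (d + 1)\<close>.\<close>
    also have "- z\<^sup>2 / 2 + d * w = - (1 / (real d + 1)) * z\<^sup>2 / 2 + 0 * z"
      using c by (simp add: a_def w_def power_mult_distrib divide_simps) (simp add: algebra_simps)
    finally show "(\<integral>\<^sup>+x. h z x \<partial>?P) =
       ennreal (sqrt (2 * pi / a) ^ d / sqrt (2 * pi)) * ennreal (exp (- (1 / (real d + 1)) * z\<^sup>2 / 2 + 0 * z))"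
      using a by (simp add: ennreal_mult'[symmetric])
  qed
  also have "\<dots> = ennreal (sqrt (2 * pi / a) ^ d / sqrt (2 * pi)) * ennreal (sqrt (2 * pi / (1 / (real d + 1))) * exp (0\<^sup>2 / (2 * (1 / (real d + 1)))))"
    by (subst nn_integral_cmult, measurable) (subst nn_integral_exp_quadratic, auto)
  also have "\<dots> = ennreal (sqrt (real d + 1) * sqrt (2 * pi / a) ^ d)"
    using a by (simp add: ennreal_mult'[symmetric] real_sqrt_mult)
  finally show ?thesis by (simp add: a_def)
qed

section \<open>Pointwise limit and domination of the scaled kernel\<close>

text \<open>Factor j of the kernel averages over everybody but j, and its Gaussian limit involves
  the squared deviations from the mean \<open>(T - t j) / d\<close> of these d values. Their total
  over j is the quadratic form of the limit.\<close>

lemma sum_variance_angle: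
  fixes t :: "nat \<Rightarrow> real"
  assumes d: "d > 0"
  defines "T \<equiv> \<Sum>i<Suc d. t i"
  shows "(\<Sum>j<Suc d. \<Sum>i\<in>{..<Suc d} - {j}. (t i - (T - t j) / d)\<^sup>2) =
     (real d - 1) / d * ((real d + 1) * (\<Sum>i<Suc d. (t i)\<^sup>2) - T\<^sup>2)"
proof -
  define U where "U = (\<Sum>i<Suc d. (t i)\<^sup>2)"
  have "(\<Sum>i\<in>{..<Suc d} - {j}. (t i - (T - t j) / d)\<^sup>2) = U - (t j)\<^sup>2 - (T - t j)\<^sup>2 / d" if j: "j < Suc d" for j
  proof -
    define \<mu> where "\<mu> = (T - t j) / d"
    have 1: "(\<Sum>i\<in>{..<Suc d} - {j}. t i) = d * \<mu>"
      using d j by (simp add: sum_diff1 T_def \<mu>_def del: sum.lessThan_Suc)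
    have 2: "(\<Sum>i\<in>{..<Suc d} - {j}. (t i)\<^sup>2) = U - (t j)\<^sup>2"
      using j by (simp add: sum_diff1 U_def del: sum.lessThan_Suc)
    have "(\<Sum>i\<in>{..<Suc d} - {j}. (t i - \<mu>)\<^sup>2) =
       (\<Sum>i\<in>{..<Suc d} - {j}. (t i)\<^sup>2 - 2 * \<mu> * t i + \<mu>\<^sup>2)"
      by (simp add: power2_diff algebra_simps)
    also have "\<dots> = U - (t j)\<^sup>2 - 2 * \<mu> * (d * \<mu>) + d * \<mu>\<^sup>2"
      using j unfolding sum.distrib sum_subtractf sum_distrib_left[symmetric] 1 2 by simp
    also have "\<dots> = U - (t j)\<^sup>2 - (T - t j)\<^sup>2 / d"
      using d by (simp add: \<mu>_def power2_eq_square)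
    finally show ?thesis by (simp add: \<mu>_def)
  qed
  then have "(\<Sum>j<Suc d. \<Sum>i\<in>{..<Suc d} - {j}. (t i - (T - t j) / d)\<^sup>2) =
     (\<Sum>j<Suc d. U - (t j)\<^sup>2 - (T\<^sup>2 - 2 * T * t j + (t j)\<^sup>2) / d)"
    by (intro sum.cong) (auto simp: power2_diff algebra_simps)
  also have "\<dots> = (d + 1) * U - U - ((d + 1) * T\<^sup>2 - 2 * T * T + U) / d"
    unfolding sum_subtractf sum.distrib sum_divide_distrib[symmetric] sum_distrib_left[symmetric]
    by (simp add: U_def[symmetric] T_def[symmetric] del: sum.lessThan_Suc)
  also have "\<dots> = (real d - 1) / d * ((real d + 1) * U - T\<^sup>2)"
    using d by (simp add: field_simps power2_eq_square)
  finally show ?thesis by (simp add: U_def)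
qed

lemma sum_angle: "(\<Sum>i<Suc d. angle d x i) = (\<Sum>i<d. x i)"
  by (simp add: angle_def)

lemma sum_angle_sq: "(\<Sum>i<Suc d. (angle d x i)\<^sup>2) = (\<Sum>i<d. (x i)\<^sup>2)"
  by (simp add: angle_def)

text \<open>The \<open>Suc d * n\<close> sums of d unit numbers become averages, and
  \<open>r = sqrt n\<close> is the scale on which their n-th powers have a limit.\<close>

definition scaled_kernel :: "nat \<Rightarrow> nat \<Rightarrow> (nat \<Rightarrow> real) \<Rightarrow> complex" where
  "scaled_kernel d n x = deal_kernel d n (sqrt (real n)) x / of_nat d ^ (Suc d * n)"

text \<open>The phases split off by centring each factor at its mean angle cancel those of the
  coefficient extraction.\<close>

lemma scaled_kernel_centred:
  assumes d: "d > 0"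
  defines "\<mu> \<equiv> \<lambda>x j. ((\<Sum>i<d. x i) - angle d x j) / d"
  shows "scaled_kernel d n x =
     (\<Prod>i<d. indicator {-(pi * sqrt n)..pi * sqrt n} (x i)) *
     (\<Prod>j<Suc d. ((\<Sum>i\<in>{..<Suc d} - {j}. cis ((angle d x i - \<mu> x j) / sqrt n)) / of_nat d) ^ n)"
proof -
  have 1: "(\<Sum>i\<in>{..<Suc d} - {j}. cis (angle d x i / sqrt n)) =
     cis (\<mu> x j / sqrt n) * (\<Sum>i\<in>{..<Suc d} - {j}. cis ((angle d x i - \<mu> x j) / sqrt n))" for j
    by (simp add: sum_distrib_left cis_mult diff_divide_distrib)
  \<comment> \<open>Each angle enters d of the means with weight \<open>1 / d\<close>.\<close>
  have sum\<mu>: "(\<Sum>j<Suc d. \<mu> x j) = (\<Sum>i<d. x i)"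
    unfolding \<mu>_def sum_divide_distrib[symmetric] sum_subtractf sum_angle using d by (simp add: algebra_simps)
  have cis_sum: "(\<Prod>i\<in>I. cis (f i)) = cis (sum f I)" for I and f :: "nat \<Rightarrow> real"
    by (induction I rule: infinite_finite_induct) (auto simp: cis_mult)
  have 2: "(\<Prod>j<Suc d. cis (\<mu> x j / sqrt n)) ^ n * (\<Prod>i<d. cis (- (real n * x i / sqrt n))) = 1"
    unfolding cis_sum sum_negf sum_divide_distrib[symmetric] sum_distrib_left[symmetric] sum\<mu>
    by (simp add: Complex.DeMoivre cis_mult)
  have ind: "(\<Prod>i<d. indicator {-(pi * sqrt n)..pi * sqrt n} (x i) *\<^sub>R cis (- (real n * x i / sqrt n))) =
     (\<Prod>i<d. indicator {-(pi * sqrt n)..pi * sqrt n} (x i)) * (\<Prod>i<d. cis (- (real n * x i / sqrt n)))"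
    unfolding prod.distrib[symmetric] by (intro prod.cong) (auto simp: indicator_def)
  have pow: "(of_nat d :: complex) ^ (Suc d * n) = (\<Prod>j<Suc d. of_nat d) ^ n"
    by (simp only: prod_constant card_lessThan power_mult)
  have "scaled_kernel d n x = (\<Prod>i<d. indicator {-(pi * sqrt n)..pi * sqrt n} (x i)) *
     ((\<Prod>j<Suc d. cis (\<mu> x j / sqrt n)) ^ n * (\<Prod>i<d. cis (- (real n * x i / sqrt n)))) *
     ((\<Prod>j<Suc d. (\<Sum>i\<in>{..<Suc d} - {j}. cis ((angle d x i - \<mu> x j) / sqrt n))) ^ n / of_nat d ^ (Suc d * n))"
    unfolding scaled_kernel_def deal_kernel_def 1 ind prod.distrib power_mult_distrib
    by (simp only: mult_ac times_divide_eq_left times_divide_eq_right)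
  also have "(\<Prod>j<Suc d. (\<Sum>i\<in>{..<Suc d} - {j}. cis ((angle d x i - \<mu> x j) / sqrt n))) ^ n / of_nat d ^ (Suc d * n) =
     (\<Prod>j<Suc d. ((\<Sum>i\<in>{..<Suc d} - {j}. cis ((angle d x i - \<mu> x j) / sqrt n)) / of_nat d) ^ n)"
    unfolding pow prod_power_distrib[symmetric] prod_dividef power_divide ..
  finally show ?thesis unfolding 2 by simp
qed

text \<open>For fixed x the growing box eventually contains x, and each centred average falls under
  \<open>cis_uniform_power_limit\<close>. The \<open>d + 1\<close> exponents add up by
  \<open>sum_variance_angle\<close>.\<close>

lemma scaled_kernel_limit:
  assumes d: "d > 0"
  shows "(\<lambda>n. scaled_kernel d n x) \<longlonglongrightarrow>
     of_real (exp (- ((real d - 1) / (real d)\<^sup>2 / 2) * ((real d + 1) * (\<Sum>i<d. (x i)\<^sup>2) - (\<Sum>i<d. x i)\<^sup>2)))"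
proof -
  define \<mu> where "\<mu> j = ((\<Sum>i<d. x i) - angle d x j) / d" for j
  let ?A = "\<lambda>j. {..<Suc d} - {j}"
  define V where "V j = (\<Sum>i\<in>?A j. (angle d x i - \<mu> j)\<^sup>2)" for j
  have "(\<lambda>n. (\<Prod>i<d. indicator {-(pi * sqrt (real n))..pi * sqrt (real n)} (x i) :: complex)) \<longlonglongrightarrow> (\<Prod>i<d. 1)"
  proof (rule tendsto_prod)
    fix i
    have "filterlim (\<lambda>n. pi * sqrt (real n)) at_top sequentially"
      by (intro filterlim_tendsto_pos_mult_at_top[OF tendsto_const pi_gt_zero]
            filterlim_compose[OF sqrt_at_top] filterlim_real_sequentially)
    then have "\<forall>\<^sub>F n in sequentially. \<bar>x i\<bar> \<le> pi * sqrt (real n)"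
      by (simp add: filterlim_at_top)
    then have "\<forall>\<^sub>F n in sequentially. indicator {-(pi * sqrt (real n))..pi * sqrt (real n)} (x i) = (1 :: complex)"
      by eventually_elim (auto simp: indicator_def abs_le_iff)
    then show "(\<lambda>n. indicator {-(pi * sqrt (real n))..pi * sqrt (real n)} (x i) :: complex) \<longlonglongrightarrow> 1"
      by (rule tendsto_eventually)
  qed
  moreover have "(\<lambda>n. \<Prod>j<Suc d. ((\<Sum>i\<in>?A j. cis ((angle d x i - \<mu> j) / sqrt n)) / of_nat d) ^ n) \<longlonglongrightarrow>
     (\<Prod>j<Suc d. of_real (exp (- V j / (2 * real d))))"
  proof (rule tendsto_prod)
    fix j assume "j \<in> {..<Suc d}"
    then have card: "card (?A j) = d" by simp
    have nonempty: "?A j \<noteq> {}"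
    proof
      assume "?A j = {}"
      then have "card (?A j) = 0" by (simp only: card.empty)
      with card d show False by linarith
    qed
    have "(\<Sum>i\<in>?A j. angle d x i - \<mu> j) = 0"
      using \<open>j \<in> _\<close> d unfolding sum_subtractf
      by (simp add: sum_diff1 sum_angle \<mu>_def del: sum.lessThan_Suc)
    then show "(\<lambda>n. ((\<Sum>i\<in>?A j. cis ((angle d x i - \<mu> j) / sqrt n)) / of_nat d) ^ n) \<longlonglongrightarrow> of_real (exp (- V j / (2 * real d)))"
      using cis_uniform_power_limit[of "?A j" "\<lambda>i. angle d x i - \<mu> j"] nonempty
      unfolding card V_def by simp
  qed
  ultimately have "(\<lambda>n. scaled_kernel d n x) \<longlonglongrightarrow> (\<Prod>i<d. 1) * (\<Prod>j<Suc d. of_real (exp (- V j / (2 * real d))))"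
    unfolding scaled_kernel_centred[OF d] \<mu>_def by (rule tendsto_mult)
  also have "(\<Prod>i<d. 1) * (\<Prod>j<Suc d. complex_of_real (exp (- V j / (2 * real d)))) =
      of_real (exp (- (\<Sum>j<Suc d. V j) / (2 * real d)))"
    by (simp only: of_real_prod[symmetric] exp_sum[symmetric] finite_lessThan prod.neutral_const mult_1
          sum_divide_distrib[symmetric] sum_negf)
  also have "(\<Sum>j<Suc d. V j) = (real d - 1) / d * ((real d + 1) * (\<Sum>i<d. (x i)\<^sup>2) - (\<Sum>i<d. x i)\<^sup>2)"
    unfolding V_def \<mu>_def using sum_variance_angle[OF d, of "angle d x"] unfolding sum_angle sum_angle_sq .
  finally show ?thesis using d by (simp add: power2_eq_square mult_ac)
qed

text \<open>Outside the box the kernel vanishes. Inside, every factor \<open>j < d\<close> contains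
  the zero angle of player d, so \<open>norm_average_cis_le\<close> applies to the uncentred
  angles.\<close>

lemma norm_scaled_kernel_le:
  assumes d: "d \<ge> 2" and n: "n > 0"
  shows "norm (scaled_kernel d n x) \<le> (\<Prod>i<d. exp (- (x i)\<^sup>2 / (36 * (real d)\<^sup>2)))"
proof (cases "\<forall>i<d. \<bar>x i\<bar> \<le> pi * sqrt n")
  case False
  then obtain i where i: "i < d" "x i \<notin> {-(pi * sqrt n)..pi * sqrt n}" by (auto simp: abs_le_iff)
  have "(\<Prod>i<d. indicator {-(pi * sqrt n)..pi * sqrt n} (x i) *\<^sub>R cis (- (real n * x i / sqrt n))) = 0"
    using i by (intro prod_zero bexI[of _ i]) auto
  then have "scaled_kernel d n x = 0"
    by (simp add: scaled_kernel_def deal_kernel_def)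
  then show ?thesis by (simp add: prod_nonneg)
next
  case True
  let ?A = "\<lambda>j. {..<Suc d} - {j}"
  define \<theta> where "\<theta> i = angle d x i / sqrt n" for i
  define z where "z j = (\<Sum>i\<in>?A j. cis (\<theta> i)) / of_nat d" for j
  define U where "U = (\<Sum>i<d. (x i)\<^sup>2)"
  have \<theta>_le: "\<bar>\<theta> i\<bar> \<le> pi" if "i < Suc d" for i
    using True that n by (auto simp: \<theta>_def angle_def divide_le_eq)
  have card: "card (?A j) = d" if "j < Suc d" for j using that by simp
  \<comment> \<open>This factor omits player d and hence the guaranteed zero angle; it gets the
    trivial bound.\<close>
  have zd: "norm (z d) \<le> 1"
  proof -
    have "norm (\<Sum>i\<in>?A d. cis (\<theta> i)) \<le> card (?A d)"
      by (rule order_trans[OF norm_sum]) simp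
    then show ?thesis using d by (simp add: z_def norm_divide)
  qed
  have zj: "norm (z j) \<le> exp (- (\<Sum>i\<in>?A j. (\<theta> i)\<^sup>2) / (36 * (real d)\<^sup>2))" if j: "j < d" for j
    using norm_average_cis_le[of "?A j" d \<theta>] \<theta>_le j card[of j] by (simp add: z_def \<theta>_def angle_def)
  have sq: "(\<Sum>i<Suc d. (\<theta> i)\<^sup>2) = U / n"
    using n by (simp add: \<theta>_def power_divide sum_divide_distrib[symmetric] sum_angle_sq U_def del: sum.lessThan_Suc)
  \<comment> \<open>Each angle occurs in \<open>d - 1\<close> of the first d factors, and
    \<open>d \<ge> 2\<close> makes this at least once.\<close>
  have "U / n \<le> (\<Sum>j<d. \<Sum>i\<in>?A j. (\<theta> i)\<^sup>2)"
  proof -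
    have "(\<Sum>j<d. \<Sum>i\<in>?A j. (\<theta> i)\<^sup>2) = (\<Sum>j<d. U / n - (\<theta> j)\<^sup>2)"
      by (intro sum.cong) (auto simp: sum_diff1 sq simp del: sum.lessThan_Suc)
    also have "\<dots> = d * (U / n) - U / n"
      using sq by (simp add: sum_subtractf \<theta>_def angle_def)
    also have "\<dots> \<ge> 2 * (U / n) - U / n"
      using d by (intro diff_right_mono mult_right_mono) (auto simp: U_def intro!: divide_nonneg_nonneg sum_nonneg)
    finally show ?thesis by simp
  qed
  have pow: "real d ^ (Suc d * n) = (\<Prod>j<Suc d. real d) ^ n"
    by (simp only: prod_constant card_lessThan power_mult)
  have box: "x i \<in> {-(pi * sqrt n)..pi * sqrt n}" if "i < d" for i
    using True that by (auto simp: abs_le_iff)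
  have "norm (scaled_kernel d n x) = (\<Prod>j<Suc d. norm (z j)) ^ n"
  proof -
    have "norm (\<Prod>i<d. indicator {-(pi * sqrt n)..pi * sqrt n} (x i) *\<^sub>R cis (- (real n * x i / sqrt n))) = 1"
      unfolding prod_norm[symmetric] using box by (intro prod.neutral) auto
    moreover have "(\<Prod>j<Suc d. norm (z j)) ^ n = norm (\<Prod>j<Suc d. \<Sum>i\<in>?A j. cis (\<theta> i)) ^ n / real d ^ (Suc d * n)"
      unfolding z_def norm_divide prod_dividef prod_norm power_divide pow norm_of_nat ..
    ultimately show ?thesis
      by (simp add: scaled_kernel_def deal_kernel_def norm_mult norm_divide norm_power \<theta>_def
            del: prod.lessThan_Suc power_Suc)
  qed
  also have "\<dots> \<le> (\<Prod>j<d. exp (- (\<Sum>i\<in>?A j. (\<theta> i)\<^sup>2) / (36 * (real d)\<^sup>2))) ^ n"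
  proof (rule power_mono)
    have "(\<Prod>j<Suc d. norm (z j)) \<le> (\<Prod>j<d. norm (z j)) * 1"
      unfolding prod.lessThan_Suc by (intro mult_left_mono zd prod_nonneg) auto
    also have "\<dots> \<le> (\<Prod>j<d. exp (- (\<Sum>i\<in>?A j. (\<theta> i)\<^sup>2) / (36 * (real d)\<^sup>2)))"
      unfolding mult_1_right by (intro prod_mono) (use zj in auto)
    finally show "(\<Prod>j<Suc d. norm (z j)) \<le> \<dots>" .
  qed (intro prod_nonneg, auto)
  also have "\<dots> = exp (- (n * (\<Sum>j<d. \<Sum>i\<in>?A j. (\<theta> i)\<^sup>2)) / (36 * (real d)\<^sup>2))"
    by (simp only: exp_sum[symmetric] finite_lessThan exp_of_nat_mult[symmetric] sum_divide_distrib[symmetric]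
        sum_negf times_divide_eq_right mult_minus_right)
  \<comment> \<open>The n-th power cancels the \<open>1 / n\<close> from the scaling, so the bound
    is independent of n.\<close>
  also have "\<dots> \<le> exp (- U / (36 * (real d)\<^sup>2))"
    using \<open>U / n \<le> _\<close> n by (simp add: field_simps divide_right_mono)
  also have "\<dots> = (\<Prod>i<d. exp (- (x i)\<^sup>2 / (36 * (real d)\<^sup>2)))"
    by (simp add: U_def exp_sum[symmetric] sum_divide_distrib[symmetric] sum_negf)
  finally show ?thesis .
qed

section \<open>Dominated convergence and the closed form\<close>

lemma scaled_kernel_integral_limit:
  assumes d: "d \<ge> 2"
  shows "(\<lambda>n. \<integral>x. scaled_kernel d n x \<partial>Pi\<^sub>M {..<d} (\<lambda>_. lborel)) \<longlonglongrightarrow>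
     of_real (sqrt (real d + 1) * sqrt (2 * pi / ((real d - 1) / (real d)\<^sup>2 * (real d + 1))) ^ d)"
proof -
  interpret product_sigma_finite "\<lambda>_::nat. lborel :: real measure" by standard
  let ?P = "Pi\<^sub>M {..<d} (\<lambda>_. lborel :: real measure)"
  define c where "c = (real d - 1) / (real d)\<^sup>2"
  define G where "G x = exp (- (c / 2) * ((real d + 1) * (\<Sum>i<d. (x i)\<^sup>2) - (\<Sum>i<d. x i)\<^sup>2))" for x :: "nat \<Rightarrow> real"
  define w where "w x = (\<Prod>i<d. exp (- (x i)\<^sup>2 / (36 * (real d)\<^sup>2)))" for x :: "nat \<Rightarrow> real"
  have c: "c > 0" using d by (simp add: c_def)
  have [measurable]: "G \<in> borel_measurable ?P" unfolding G_def by measurable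
  have [measurable]: "(\<lambda>x. angle d x i) \<in> borel_measurable ?P" for i
    by (cases "i < d") (auto simp: angle_def)
  have [measurable]: "scaled_kernel d n \<in> borel_measurable ?P" for n
    unfolding scaled_kernel_def deal_kernel_def cis_conv_exp by measurable
  have "integrable lborel (\<lambda>t::real. exp (- t\<^sup>2 / (36 * (real d)\<^sup>2)))"
  proof -
    \<comment> \<open>The dominating Gaussian is the case \<open>a = 1 / (18 * d\<^sup>2)\<close>,
      \<open>b = 0\<close>.\<close>
    have "(\<integral>\<^sup>+t. ennreal (exp (- (1 / (18 * (real d)\<^sup>2)) * t\<^sup>2 / 2 + 0 * t)) \<partial>lborel) < \<infinity>"
      using d by (subst nn_integral_exp_quadratic) auto
    then show ?thesis by (intro integrableI_nonneg) auto
  qed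
  then have w: "integrable ?P w"
    unfolding w_def by (intro product_integrable_prod) auto
  have "(\<lambda>n. \<integral>x. scaled_kernel d (Suc n) x \<partial>?P) \<longlonglongrightarrow> (\<integral>x. complex_of_real (G x) \<partial>?P)"
  proof (rule integral_dominated_convergence[where w = w])
    show "AE x in ?P. (\<lambda>n. scaled_kernel d (Suc n) x) \<longlonglongrightarrow> complex_of_real (G x)"
      using scaled_kernel_limit[of d] d unfolding G_def c_def by (intro AE_I2 LIMSEQ_Suc) auto
    show "AE x in ?P. norm (scaled_kernel d (Suc n) x) \<le> w x" for n
      using norm_scaled_kernel_le[OF d] by (auto simp: w_def)
  qed (use w in measurable)
  moreover have "(\<integral>x. G x \<partial>?P) = sqrt (real d + 1) * sqrt (2 * pi / (c * (real d + 1))) ^ d"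
    using nn_integral_exp_equicorrelated[OF c, of d] c
    by (intro integral_eq_nn_integral[THEN trans]) (auto simp: G_def)
  ultimately have "(\<lambda>n. \<integral>x. scaled_kernel d (Suc n) x \<partial>?P) \<longlonglongrightarrow>
      of_real (sqrt (real d + 1) * sqrt (2 * pi / (c * (real d + 1))) ^ d)"
    by (simp only: integral_complex_of_real)
  then show ?thesis unfolding c_def by (rule LIMSEQ_imp_Suc)
qed

theorem mainTheorem14:
  fixes S :: nat
  assumes "S \<ge> 3"
  shows "(\<lambda>m::nat. real (E S (\<lambda>_. m))) \<sim>[at_top]
         (\<lambda>m::nat. sqrt (real S) * (real S - 1) ^ (S * m + S - 1) /
                    (2 * real S * (real S - 2) * pi * real m) powr ((real S - 1) / 2))"
proof -
  define d where "d = S - 1"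
  have d: "d \<ge> 2" and S: "S = Suc d" using assms by (auto simp: d_def)
  define L where "L = sqrt (real d + 1) * sqrt (2 * pi / ((real d - 1) / (real d)\<^sup>2 * (real d + 1))) ^ d"
  have L: "L > 0" using d by (auto simp: L_def intro!: mult_pos_pos divide_pos_pos zero_less_power)
  \<comment> \<open>The period volume for \<open>r = sqrt n\<close> over the normalisation of
    \<open>scaled_kernel\<close>, so that for positive n the integral equals E times
    \<open>q n\<close> exactly.\<close>
  define q where "q n = (2 * pi * sqrt (real n)) ^ d / real d ^ (Suc d * n)" for n
  have "(\<lambda>n. complex_of_real (real (E S (\<lambda>_. n)) * q n)) \<longlonglongrightarrow> of_real L"
  proof (rule Lim_transform_eventually)
    show "(\<lambda>n. \<integral>x. scaled_kernel d n x \<partial>Pi\<^sub>M {..<d} (\<lambda>_. lborel)) \<longlonglongrightarrow> of_real L"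
      unfolding L_def by (rule scaled_kernel_integral_limit[OF d])
    show "\<forall>\<^sub>F n in sequentially. (\<integral>x. scaled_kernel d n x \<partial>Pi\<^sub>M {..<d} (\<lambda>_. lborel)) =
        complex_of_real (real (E S (\<lambda>_. n)) * q n)"
      using eventually_gt_at_top[of 0]
      by eventually_elim (simp add: scaled_kernel_def integral_deal_kernel S q_def)
  qed
  then have lim: "(\<lambda>n. real (E S (\<lambda>_. n)) * q n / L) \<longlonglongrightarrow> 1"
    using L tendsto_divide[OF _ tendsto_const, of _ L sequentially L]
    unfolding tendsto_of_real_iff by fastforce
  show ?thesis
  \<comment> \<open>What remains is the exact identity of \<open>L / q n\<close> with the closed
    form for \<open>n > 0\<close>.\<close>
  proof (rule asymp_equivI', rule Lim_transform_eventually[OF lim])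
    show "\<forall>\<^sub>F n in sequentially. real (E S (\<lambda>_. n)) * q n / L =
        real (E S (\<lambda>_. n)) / (sqrt (real S) * (real S - 1) ^ (S * n + S - 1) /
          (2 * real S * (real S - 2) * pi * real n) powr ((real S - 1) / 2))"
      using eventually_gt_at_top[of 0]
    proof eventually_elim
      case (elim n)
      define B where "B = 2 * real S * (real S - 2) * pi * real n"
      have B: "B > 0" using d elim by (simp add: B_def S)
      define K where "K = 2 * pi * sqrt n"
      have K: "K > 0" using elim by (simp add: K_def)
      have Bpow: "B powr ((real S - 1) / 2) = sqrt B ^ d"
        using B by (simp add: powr_half_sqrt[symmetric] powr_power S)
      have L_eq: "L = sqrt (real S) * (real d * K / sqrt B) ^ d"
      proof -
        \<comment> \<open>Both sides equal \<open>2 * pi * d\<^sup>2 / ((d - 1) * (d + 1))\<close>.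
          Written through K and B, the d-th power of K cancels the one in
          \<open>q n\<close>.\<close>
        have "2 * pi / ((real d - 1) / (real d)\<^sup>2 * (real d + 1)) = (real d * K / sqrt B)\<^sup>2"
          using d elim B by (simp add: power_divide power_mult_distrib K_def) (simp add: B_def S field_simps power2_eq_square)
        then have "sqrt (2 * pi / ((real d - 1) / (real d)\<^sup>2 * (real d + 1))) = real d * K / sqrt B"
          using B K by simp
        then show ?thesis by (simp add: L_def S add.commute)
      qed
      have S_pow: "(real S - 1) ^ (S * n + S - 1) = real d ^ (Suc d * n) * real d ^ d"
        by (simp add: S power_add)
      show ?case
        unfolding B_def[symmetric] Bpow S_pow q_def K_def[symmetric] L_eq using B K d
        by (simp add: power_mult_distrib power_divide field_simps del: power_Suc)
    qed
  qed
qed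

end
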